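(* In each calculus of the family $\mathsf{CL}^*$ the cut rule is admissible: for every relational atom or labelled formula $\mathcal{F}$, if $\Gamma\Rightarrow\Delta,\mathcal{F}$ and $\mathcal{F},\Gamma'\Rightarrow\Delta'$ are derivable, then $\Gamma,\Gamma'\Rightarrow\Delta,\Delta'$ is derivable.
   Context: Syntax: world labels $x,y,z,\dots$; neighbourhood labels $a,b,c,\dots$, including $\{x\}$ for each world label $x$. Relational atoms: $a\in N(x)$, $x\in a$, $a\subseteq b$. Labelled formulas: relational atoms, $x:A$, $a\Vdash^{\exists}A$, $a\Vdash^{\forall}A$, $x\Vdash_aA|B$ for formulas of $\mathcal{L}::=p\mid\bot\mid A\wedge B\mid A\lor B\mid A\to B\mid A>B$. Sequents $\Gamma\Rightarrow\Delta$: multisets, relational atoms only in the antecedent. Rules of $\mathsf{CL}$ ("(u!)": $u$ not in conclusion; premisses / conclusion): initial sequents $x:p,\Gamma\Rightarrow\Delta,x:p$ ($p$ atomic), $x:\bot,\Gamma\Rightarrow\Delta$; G3 rules for $\wedge,\vee,\to$ on $x:A$; L$\forall$: $x:A,x\in a,a\Vdash^\forall A,\Gamma\Rightarrow\Delta$ / $x\in a,a\Vdash^\forall A,\Gamma\Rightarrow\Delta$; R$\forall$(x!): $x\in a,\Gamma\Rightarrow\Delta,x:A$ / $\Gamma\Rightarrow\Delta,a\Vdash^\forall A$; L$\exists$(x!): $x\in a,x:A,\Gamma\Rightarrow\Delta$ / $a\Vdash^\exists A,\Gamma\Rightarrow\Delta$; R$\exists$: $x\in a,\Gamma\Rightarrow\Delta,x:A,a\Vdash^\exists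 A$ / $x\in a,\Gamma\Rightarrow\Delta,a\Vdash^\exists A$; R$>$(a!): $a\in N(x),a\Vdash^\exists A,\Gamma\Rightarrow\Delta,x\Vdash_aA|B$ / $\Gamma\Rightarrow\Delta,x:A>B$; L$>$: $a\in N(x),x:A>B,\Gamma\Rightarrow\Delta,a\Vdash^\exists A$ and $x\Vdash_aA|B,a\in N(x),x:A>B,\Gamma\Rightarrow\Delta$ / $a\in N(x),x:A>B,\Gamma\Rightarrow\Delta$; R$|$: $c\in N(x),c\subseteq a,\Gamma\Rightarrow\Delta,x\Vdash_aA|B,c\Vdash^\exists A$ and $c\in N(x),c\subseteq a,\Gamma\Rightarrow\Delta,x\Vdash_aA|B,c\Vdash^\forall A\to B$ / $c\in N(x),c\subseteq a,\Gamma\Rightarrow\Delta,x\Vdash_aA|B$; L$|$(c!): $c\in N(x),c\subseteq a,c\Vdash^\exists A,c\Vdash^\forall A\to B,\Gamma\Rightarrow\Delta$ / $x\Vdash_aA|B,\Gamma\Rightarrow\Delta$; Ref: $a\subseteq a,\Gamma\Rightarrow\Delta$ / $\Gamma\Rightarrow\Delta$; Tr: $c\subseteq a,c\subseteq b,b\subseteq a,\Gamma\Rightarrow\Delta$ / $c\subseteq b,b\subseteq a,\Gamma\Rightarrow\Delta$; L$\subseteq$: $x\in a,a\subseteq b,x\in b,\Gamma\Rightarrow\Delta$ / $x\in a,a\subseteq b,\Gamma\Rightarrow\Delta$. Extension rules: N(a!): $a\in N(x),\Gamma\Rightarrow\Delta$ / $\Gamma\Rightarrow\Delta$; 0(y!):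 $y\in a,a\in N(x),\Gamma\Rightarrow\Delta$ / $a\in N(x),\Gamma\Rightarrow\Delta$; T(a!): $x\in a,a\in N(x),\Gamma\Rightarrow\Delta$ / $\Gamma\Rightarrow\Delta$; W: $x\in a,a\in N(x),\Gamma\Rightarrow\Delta$ / $a\in N(x),\Gamma\Rightarrow\Delta$; Single: $x\in\{x\},\{x\}\in N(x),\Gamma\Rightarrow\Delta$ / $\{x\}\in N(x),\Gamma\Rightarrow\Delta$; C: $\{x\}\in N(x),\{x\}\subseteq a,a\in N(x),\Gamma\Rightarrow\Delta$ / $a\in N(x),\Gamma\Rightarrow\Delta$; Repl$_1$: $y\in\{x\},At(x),At(y),\Gamma\Rightarrow\Delta$ / $y\in\{x\},At(x),\Gamma\Rightarrow\Delta$; Repl$_2$: same premiss / $y\in\{x\},At(y),\Gamma\Rightarrow\Delta$, with $At(x)$ among $x:P$ ($P$ atomic), $x\in a$, $a\in N(x)$, $x\in\{z\}$; U$_1$(c!): $z\in c,c\in N(x),a\in N(x),y\in a,b\in N(y),z\in b,\Gamma\Rightarrow\Delta$ / $a\in N(x),y\in a,b\in N(y),z\in b,\Gamma\Rightarrow\Delta$; U$_2$(c!): $z\in c,c\in N(y),a\in N(x),y\in a,b\in N(x),z\in b,\Gamma\Rightarrow\Delta$ / $a\in N(x),y\in a,b\in N(x),z\in b,\Gamma\Rightarrow\Delta$; A$_1$: $b\in N(y),a\in N(x),y\in a,b\in N(x),\Gamma\Rightarrow\Delta$ / $a\in N(x),y\in a,b\in N(x),\Gamma\Rightarrow\Delta$;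 A$_2$: $b\in N(x),a\in N(x),y\in a,b\in N(y),\Gamma\Rightarrow\Delta$ / $a\in N(x),y\in a,b\in N(y),\Gamma\Rightarrow\Delta$; plus contracted instances of U$_1$,U$_2$,A$_1$. Family $\mathsf{CL}^*$: $\mathsf{CL}$; $\mathsf{CL}^N=\mathsf{CL}+$N,0; $\mathsf{CL}^T=\mathsf{CL}^N+$T; $\mathsf{CL}^W=\mathsf{CL}^T+$W; $\mathsf{CL}^C=\mathsf{CL}^W+$C,Single,Repl$_1$,Repl$_2$; $\mathsf{CL}^U=\mathsf{CL}+$U$_1$,U$_2$; $\mathsf{CL}^{NU},\dots,\mathsf{CL}^{CU}$ = $\mathsf{CL}^N,\dots,\mathsf{CL}^C$ + U$_1$,U$_2$; $\mathsf{CL}^A=\mathsf{CL}+$A$_1$,A$_2$; $\mathsf{CL}^{NA},\dots,\mathsf{CL}^{CA}$ = $\mathsf{CL}^N,\dots,\mathsf{CL}^C$ + A$_1$,A$_2$. *)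

theory Defs
  imports Main "HOL-Library.Multiset"
begin

datatype form =
    Atom nat
  | Bot
  | Conj form form
  | Disj form form
  | Impl form form
  | Cond form form

text \<open>World labels are natural numbers. Neighbourhood labels are either variables a,b,c,...
  (NV n) or singleton labels {x} (Sg x) for a world label x.\<close>
type_synonym wlab = nat

datatype nlab = NV nat | Sg wlab

datatype lf =
    InN nlab wlab             (* a \<in> N(x) *)
  | Mem wlab nlab
  | Sub nlab nlab
  | Lab wlab form
  | Ex nlab form              (* a \<Vdash>\<exists> A *)
  | Fa nlab form              (* a \<Vdash>\<forall> A *)
  | CondF wlab nlab form form (* x \<Vdash>_a A|B *)

fun wl_n :: "nlab \<Rightarrow> wlab set" where
  "wl_n (NV n) = {}"
| "wl_n (Sg x) = {x}"

fun nv_n :: "nlab \<Rightarrow> nat set" where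
  "nv_n (NV n) = {n}"
| "nv_n (Sg x) = {}"

fun wls :: "lf \<Rightarrow> wlab set" where
  "wls (InN a x) = wl_n a \<union> {x}"
| "wls (Mem x a) = {x} \<union> wl_n a"
| "wls (Sub a b) = wl_n a \<union> wl_n b"
| "wls (Lab x A) = {x}"
| "wls (Ex a A) = wl_n a"
| "wls (Fa a A) = wl_n a"
| "wls (CondF x a A B) = {x} \<union> wl_n a"

fun nvs :: "lf \<Rightarrow> nat set" where
  "nvs (InN a x) = nv_n a"
| "nvs (Mem x a) = nv_n a"
| "nvs (Sub a b) = nv_n a \<union> nv_n b"
| "nvs (Lab x A) = {}"
| "nvs (Ex a A) = nv_n a"
| "nvs (Fa a A) = nv_n a"
| "nvs (CondF x a A B) = nv_n a"

definition wls_seq :: "lf multiset \<Rightarrow> lf multiset \<Rightarrow> wlab set" where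
  "wls_seq G D = (\<Union>F\<in>set_mset (G + D). wls F)"

definition nvs_seq :: "lf multiset \<Rightarrow> lf multiset \<Rightarrow> nat set" where
  "nvs_seq G D = (\<Union>F\<in>set_mset (G + D). nvs F)"

text \<open>At(x) / At(y) pairs for the replacement rules: x:P (P a propositional variable),
  x \<in> a, a \<in> N(x), x \<in> {z} (the last is a special case of x \<in> a).\<close>
definition repl_at :: "wlab \<Rightarrow> wlab \<Rightarrow> lf \<Rightarrow> lf \<Rightarrow> bool" where
  "repl_at x y F G \<longleftrightarrow>
     (\<exists>P. F = Lab x (Atom P) \<and> G = Lab y (Atom P))
   \<or> (\<exists>a. F = Mem x a \<and> G = Mem y a)
   \<or> (\<exists>a. F = InN a x \<and> G = InN a y)
   \<or> (\<exists>z. F = Mem x (Sg z) \<and> G = Mem y (Sg z))"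

datatype level = LvBase | LvN | LvT | LvW | LvC
datatype ext = ExtNone | ExtU | ExtA

text \<open>A calculus of the family: CL^{level, ext}, e.g. (LvT, ExtU) is CL^{TU},
  (LvBase, ExtA) is CL^A, (LvBase, ExtNone) is CL.\<close>
type_synonym calc = "level \<times> ext"

fun hasN :: "calc \<Rightarrow> bool" where
  "hasN (l, e) = (l \<noteq> LvBase)"
fun hasT :: "calc \<Rightarrow> bool" where
  "hasT (l, e) = (l \<in> {LvT, LvW, LvC})"
fun hasW :: "calc \<Rightarrow> bool" where
  "hasW (l, e) = (l \<in> {LvW, LvC})"
fun hasC :: "calc \<Rightarrow> bool" where
  "hasC (l, e) = (l = LvC)"
fun hasU :: "calc \<Rightarrow> bool" where
  "hasU (l, e) = (e = ExtU)"
fun hasA :: "calc \<Rightarrow> bool" where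
  "hasA (l, e) = (e = ExtA)"

text \<open>Derivability of the sequent Gamma => Delta in calculus S.
  Contracted instances of U1, U2, A1 are captured by requiring only that the
  conclusion contains each distinct principal atom (mset (remdups ...)).\<close>
inductive derivable :: "calc \<Rightarrow> lf multiset \<Rightarrow> lf multiset \<Rightarrow> bool" for S where
  init: "derivable S (add_mset (Lab x (Atom p)) G) (add_mset (Lab x (Atom p)) D)"
| botL: "derivable S (add_mset (Lab x Bot) G) D"
| conjL: "derivable S (add_mset (Lab x A) (add_mset (Lab x B) G)) D
          \<Longrightarrow> derivable S (add_mset (Lab x (Conj A B)) G) D"
| conjR: "derivable S G (add_mset (Lab x A) D) \<Longrightarrow> derivable S G (add_mset (Lab x B) D)
          \<Longrightarrow> derivable S G (add_mset (Lab x (Conj A B)) D)"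
| disjL: "derivable S (add_mset (Lab x A) G) D \<Longrightarrow> derivable S (add_mset (Lab x B) G) D
          \<Longrightarrow> derivable S (add_mset (Lab x (Disj A B)) G) D"
| disjR: "derivable S G (add_mset (Lab x A) (add_mset (Lab x B) D))
          \<Longrightarrow> derivable S G (add_mset (Lab x (Disj A B)) D)"
| implL: "derivable S G (add_mset (Lab x A) D) \<Longrightarrow> derivable S (add_mset (Lab x B) G) D
          \<Longrightarrow> derivable S (add_mset (Lab x (Impl A B)) G) D"
| implR: "derivable S (add_mset (Lab x A) G) (add_mset (Lab x B) D)
          \<Longrightarrow> derivable S G (add_mset (Lab x (Impl A B)) D)"
| faL: "derivable S (add_mset (Lab x A) (add_mset (Mem x a) (add_mset (Fa a A) G))) D
        \<Longrightarrow> derivable S (add_mset (Mem x a) (add_mset (Fa a A) G)) D"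
| faR: "x \<notin> wls_seq G (add_mset (Fa a A) D)
        \<Longrightarrow> derivable S (add_mset (Mem x a) G) (add_mset (Lab x A) D)
        \<Longrightarrow> derivable S G (add_mset (Fa a A) D)"
| exL: "x \<notin> wls_seq (add_mset (Ex a A) G) D
        \<Longrightarrow> derivable S (add_mset (Mem x a) (add_mset (Lab x A) G)) D
        \<Longrightarrow> derivable S (add_mset (Ex a A) G) D"
| exR: "derivable S (add_mset (Mem x a) G) (add_mset (Lab x A) (add_mset (Ex a A) D))
        \<Longrightarrow> derivable S (add_mset (Mem x a) G) (add_mset (Ex a A) D)"
| condR: "n \<notin> nvs_seq G (add_mset (Lab x (Cond A B)) D)
        \<Longrightarrow> derivable S (add_mset (InN (NV n) x) (add_mset (Ex (NV n) A) G))
                        (add_mset (CondF x (NV n) A B) D)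
        \<Longrightarrow> derivable S G (add_mset (Lab x (Cond A B)) D)"
| condL: "derivable S (add_mset (InN a x) (add_mset (Lab x (Cond A B)) G)) (add_mset (Ex a A) D)
        \<Longrightarrow> derivable S (add_mset (CondF x a A B) (add_mset (InN a x) (add_mset (Lab x (Cond A B)) G))) D
        \<Longrightarrow> derivable S (add_mset (InN a x) (add_mset (Lab x (Cond A B)) G)) D"
| barR: "derivable S (add_mset (InN c x) (add_mset (Sub c a) G))
                     (add_mset (CondF x a A B) (add_mset (Ex c A) D))
        \<Longrightarrow> derivable S (add_mset (InN c x) (add_mset (Sub c a) G))
                     (add_mset (CondF x a A B) (add_mset (Fa c (Impl A B)) D))
        \<Longrightarrow> derivable S (add_mset (InN c x) (add_mset (Sub c a) G)) (add_mset (CondF x a A B) D)"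
| barL: "n \<notin> nvs_seq (add_mset (CondF x a A B) G) D
        \<Longrightarrow> derivable S (add_mset (InN (NV n) x) (add_mset (Sub (NV n) a)
                          (add_mset (Ex (NV n) A) (add_mset (Fa (NV n) (Impl A B)) G)))) D
        \<Longrightarrow> derivable S (add_mset (CondF x a A B) G) D"
| refl: "derivable S (add_mset (Sub a a) G) D \<Longrightarrow> derivable S G D"
| trans: "derivable S (add_mset (Sub c a) (add_mset (Sub c b) (add_mset (Sub b a) G))) D
        \<Longrightarrow> derivable S (add_mset (Sub c b) (add_mset (Sub b a) G)) D"
| subL: "derivable S (add_mset (Mem x a) (add_mset (Sub a b) (add_mset (Mem x b) G))) D
        \<Longrightarrow> derivable S (add_mset (Mem x a) (add_mset (Sub a b) G)) D"
| ruleN: "hasN S \<Longrightarrow> n \<notin> nvs_seq G D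
        \<Longrightarrow> derivable S (add_mset (InN (NV n) x) G) D \<Longrightarrow> derivable S G D"
| rule0: "hasN S \<Longrightarrow> y \<notin> wls_seq (add_mset (InN a x) G) D
        \<Longrightarrow> derivable S (add_mset (Mem y a) (add_mset (InN a x) G)) D
        \<Longrightarrow> derivable S (add_mset (InN a x) G) D"
| ruleT: "hasT S \<Longrightarrow> n \<notin> nvs_seq G D
        \<Longrightarrow> derivable S (add_mset (Mem x (NV n)) (add_mset (InN (NV n) x) G)) D
        \<Longrightarrow> derivable S G D"
| ruleW: "hasW S
        \<Longrightarrow> derivable S (add_mset (Mem x a) (add_mset (InN a x) G)) D
        \<Longrightarrow> derivable S (add_mset (InN a x) G) D"
| ruleSingle: "hasC S
        \<Longrightarrow> derivable S (add_mset (Mem x (Sg x)) (add_mset (InN (Sg x) x) G)) D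
        \<Longrightarrow> derivable S (add_mset (InN (Sg x) x) G) D"
| ruleC: "hasC S
        \<Longrightarrow> derivable S (add_mset (InN (Sg x) x) (add_mset (Sub (Sg x) a) (add_mset (InN a x) G))) D
        \<Longrightarrow> derivable S (add_mset (InN a x) G) D"
| repl1: "hasC S \<Longrightarrow> repl_at x y F F'
        \<Longrightarrow> derivable S (add_mset (Mem y (Sg x)) (add_mset F (add_mset F' G))) D
        \<Longrightarrow> derivable S (add_mset (Mem y (Sg x)) (add_mset F G)) D"
| repl2: "hasC S \<Longrightarrow> repl_at x y F F'
        \<Longrightarrow> derivable S (add_mset (Mem y (Sg x)) (add_mset F (add_mset F' G))) D
        \<Longrightarrow> derivable S (add_mset (Mem y (Sg x)) (add_mset F' G)) D"
| ruleU1: "hasU S \<Longrightarrow> mset (remdups [InN a x, Mem y a, InN b y, Mem z b]) \<subseteq># G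
        \<Longrightarrow> n \<notin> nvs_seq G D
        \<Longrightarrow> derivable S (add_mset (Mem z (NV n)) (add_mset (InN (NV n) x) G)) D
        \<Longrightarrow> derivable S G D"
| ruleU2: "hasU S \<Longrightarrow> mset (remdups [InN a x, Mem y a, InN b x, Mem z b]) \<subseteq># G
        \<Longrightarrow> n \<notin> nvs_seq G D
        \<Longrightarrow> derivable S (add_mset (Mem z (NV n)) (add_mset (InN (NV n) y) G)) D
        \<Longrightarrow> derivable S G D"
| ruleA1: "hasA S \<Longrightarrow> mset (remdups [InN a x, Mem y a, InN b x]) \<subseteq># G
        \<Longrightarrow> derivable S (add_mset (InN b y) G) D
        \<Longrightarrow> derivable S G D"
| ruleA2: "hasA S
        \<Longrightarrow> derivable S (add_mset (InN b x) (add_mset (InN a x) (add_mset (Mem y a) (add_mset (InN b y) G)))) D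
        \<Longrightarrow> derivable S (add_mset (InN a x) (add_mset (Mem y a) (add_mset (InN b y) G))) D"

end

theory Submission
  imports Defs
begin

text \<open>
  Derivability is compared with an infinitary calculus on sets of signed formulas in which every
  premise contains the conclusion and an eigenvariable premise is replaced by its instances for
  all labels. Weakening and contraction are then built in, every decomposition rule is invertible,
  and cut is eliminated by induction on the weight of the cut formula and on the derivation in
  which it is principal in a non-invertible way. Derivations enter this calculus together with all
  their substitution instances. For the way back, a sequent covers a signed formula if it contains
  the formula or, recursively, all formulas of some premise that decomposes it: whenever a sequent
  covers a derivable set, it is derivable, because a rule either can be applied or has already been
  applied. No inversion or contraction lemma for the original calculus is needed.
\<close>

section \<open>The cumulative calculus on sets of signed formulas\<close>

datatype sf = Ante lf | Succ lf

text \<open>These are the rules that consume their single principal formula. The second argument is the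
  set of premises, each given by the signed formulas it adds.\<close>
inductive decomp :: "sf \<Rightarrow> sf set set \<Rightarrow> bool" where
  botL: "decomp (Ante (Lab x Bot)) {}"
| conjL: "decomp (Ante (Lab x (Conj A B))) {{Ante (Lab x A), Ante (Lab x B)}}"
| conjR: "decomp (Succ (Lab x (Conj A B))) {{Succ (Lab x A)}, {Succ (Lab x B)}}"
| disjL: "decomp (Ante (Lab x (Disj A B))) {{Ante (Lab x A)}, {Ante (Lab x B)}}"
| disjR: "decomp (Succ (Lab x (Disj A B))) {{Succ (Lab x A), Succ (Lab x B)}}"
| implL: "decomp (Ante (Lab x (Impl A B))) {{Succ (Lab x A)}, {Ante (Lab x B)}}"
| implR: "decomp (Succ (Lab x (Impl A B))) {{Ante (Lab x A), Succ (Lab x B)}}"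
| faR: "decomp (Succ (Fa a A)) (range (\<lambda>x. {Ante (Mem x a), Succ (Lab x A)}))"
| exL: "decomp (Ante (Ex a A)) (range (\<lambda>x. {Ante (Mem x a), Ante (Lab x A)}))"
| condR: "decomp (Succ (Lab x (Cond A B)))
    (range (\<lambda>a. {Ante (InN a x), Ante (Ex a A), Succ (CondF x a A B)}))"
| barL: "decomp (Ante (CondF x a A B))
    (range (\<lambda>c. {Ante (InN c x), Ante (Sub c a), Ante (Ex c A), Ante (Fa c (Impl A B))}))"

text \<open>The first argument lists what must already be present, so coinciding principal atoms
  simply collapse and contracted instances are included. Neighbourhood eigenvariables range over all
  of \<open>nlab\<close>, singletons too, so that in a cut an eigenvariable premise can be
  instantiated at whatever label the opposite rule mentions.\<close>

inductive rule :: "calc \<Rightarrow> sf set \<Rightarrow> sf set set \<Rightarrow> bool" for S where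
  decomp: "decomp H \<P> \<Longrightarrow> rule S {H} \<P>"
| faL: "rule S {Ante (Mem x a), Ante (Fa a A)} {{Ante (Lab x A)}}"
| exR: "rule S {Ante (Mem x a), Succ (Ex a A)} {{Succ (Lab x A)}}"
| condL: "rule S {Ante (InN a x), Ante (Lab x (Cond A B))} {{Succ (Ex a A)}, {Ante (CondF x a A B)}}"
| barR: "rule S {Ante (InN c x), Ante (Sub c a), Succ (CondF x a A B)}
    {{Succ (Ex c A)}, {Succ (Fa c (Impl A B))}}"
| refl: "rule S {} {{Ante (Sub a a)}}"
| trans: "rule S {Ante (Sub c b), Ante (Sub b a)} {{Ante (Sub c a)}}"
| subL: "rule S {Ante (Mem x a), Ante (Sub a b)} {{Ante (Mem x b)}}"
| ruleN: "hasN S \<Longrightarrow> rule S {} (range (\<lambda>a. {Ante (InN a x)}))"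
| rule0: "hasN S \<Longrightarrow> rule S {Ante (InN a x)} (range (\<lambda>y. {Ante (Mem y a)}))"
| ruleT: "hasT S \<Longrightarrow> rule S {} (range (\<lambda>a. {Ante (Mem x a), Ante (InN a x)}))"
| ruleW: "hasW S \<Longrightarrow> rule S {Ante (InN a x)} {{Ante (Mem x a)}}"
| ruleSingle: "hasC S \<Longrightarrow> rule S {Ante (InN (Sg x) x)} {{Ante (Mem x (Sg x))}}"
| ruleC: "hasC S \<Longrightarrow> rule S {Ante (InN a x)} {{Ante (InN (Sg x) x), Ante (Sub (Sg x) a)}}"
| repl1: "hasC S \<Longrightarrow> repl_at x y F F' \<Longrightarrow> rule S {Ante (Mem y (Sg x)), Ante F} {{Ante F'}}"
| repl2: "hasC S \<Longrightarrow> repl_at x y F F' \<Longrightarrow> rule S {Ante (Mem y (Sg x)), Ante F'} {{Ante F}}"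
| ruleU1: "hasU S \<Longrightarrow> rule S {Ante (InN a x), Ante (Mem y a), Ante (InN b y), Ante (Mem z b)}
    (range (\<lambda>c. {Ante (Mem z c), Ante (InN c x)}))"
| ruleU2: "hasU S \<Longrightarrow> rule S {Ante (InN a x), Ante (Mem y a), Ante (InN b x), Ante (Mem z b)}
    (range (\<lambda>c. {Ante (Mem z c), Ante (InN c y)}))"
| ruleA1: "hasA S \<Longrightarrow> rule S {Ante (InN a x), Ante (Mem y a), Ante (InN b x)} {{Ante (InN b y)}}"
| ruleA2: "hasA S \<Longrightarrow> rule S {Ante (InN a x), Ante (Mem y a), Ante (InN b y)} {{Ante (InN b x)}}"

inductive cum :: "calc \<Rightarrow> sf set \<Rightarrow> bool" for S where
  init: "Ante (Lab x (Atom p)) \<in> \<Sigma> \<Longrightarrow> Succ (Lab x (Atom p)) \<in> \<Sigma> \<Longrightarrow> cum S \<Sigma>"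
| step: "rule S P \<P> \<Longrightarrow> P \<subseteq> \<Sigma> \<Longrightarrow> (\<And>X. X \<in> \<P> \<Longrightarrow> cum S (\<Sigma> \<union> X)) \<Longrightarrow> cum S \<Sigma>"

text \<open>Weakening leaves the shape of the derivation unchanged: without freshness conditions, no
  added formula can clash with a step.\<close>

lemma cum_mono:
  assumes "cum S \<Sigma>" and "\<Sigma> \<subseteq> \<Sigma>'"
  shows "cum S \<Sigma>'"
  using assms
proof (induction arbitrary: \<Sigma>' rule: cum.induct)
  case (init x p \<Sigma>)
  then show ?case by (blast intro: cum.init)
next
  case (step P \<P> \<Sigma>)
  show ?case
  proof (rule cum.step[OF step.hyps(1)])
    show "P \<subseteq> \<Sigma>'" using step by auto
    show "cum S (\<Sigma>' \<union> X)" if "X \<in> \<P>" for X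
      by (rule step.IH[OF that]) (use step.prems in auto)
  qed
qed

subsection \<open>Cut in the cumulative calculus\<close>

text \<open>Traversal shared by inversion and cut: \<Sigma>0 takes the place of \<open>H\<close>
  throughout a derivation, and only the steps with \<open>H\<close> principal are left to the
  caller, who receives their premises with \<open>H\<close> already replaced. At an initial sequent
  that uses \<open>H\<close> in the succedent, the matching antecedent atom survives, so
  \<open>init\<close> applies after weakening.\<close>

lemma cum_replace:
  assumes "cum S \<Sigma>1"
    and atom: "\<And>x p. H \<noteq> Ante (Lab x (Atom p))"
    and init: "\<And>x p. H = Succ (Lab x (Atom p)) \<Longrightarrow> cum S (insert (Ante (Lab x (Atom p))) \<Sigma>0)"
    and principal: "\<And>\<Sigma> P \<P>. rule S P \<P> \<Longrightarrow> H \<in> P \<Longrightarrow> P - {H} \<subseteq> \<Sigma> \<Longrightarrow> \<Sigma>0 \<subseteq> \<Sigma> \<Longrightarrow>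
      (\<And>X. X \<in> \<P> \<Longrightarrow> cum S (\<Sigma> \<union> X)) \<Longrightarrow> cum S \<Sigma>"
  shows "cum S (\<Sigma>1 - {H} \<union> \<Sigma>0)"
  using assms(1)
proof (induction rule: cum.induct)
  case (init x p \<Sigma>)
  show ?case
  proof (cases "H = Succ (Lab x (Atom p))")
    case True
    show ?thesis by (rule cum_mono[OF assms(3)[OF True]]) (use init atom in auto)
  next
    case False
    then show ?thesis using init atom[of x p] by (intro cum.init[of x p]) auto
  qed
next
  case (step P \<P> \<Sigma>)
  \<comment> \<open>If \<open>X\<close> itself contains \<open>H\<close>, the induction hypothesis
    has removed it there as well; weakening puts it back.\<close>
  have prem: "cum S (\<Sigma> - {H} \<union> \<Sigma>0 \<union> X)" if "X \<in> \<P>" for X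
    by (rule cum_mono[OF step.IH[OF that]]) auto
  show ?case
  proof (cases "H \<in> P")
    case True
    show ?thesis
      by (rule principal[OF step.hyps(1) True]) (use prem step.hyps in auto)
  next
    case False
    show ?thesis
      by (rule cum.step[OF step.hyps(1)]) (use False prem step.hyps in auto)
  qed
qed

text \<open>The rules that keep compound formulas act on antecedent \<open>Fa\<close> and
  \<open>Cond\<close> and on succedent \<open>Ex\<close> and \<open>CondF\<close>, none of which is
  decomposable; replacement touches only relational and propositional atoms.\<close>

lemma decomp_unique_rule:
  assumes "decomp H \<P>" and "rule S P \<Q>" and "H \<in> P"
  shows "P = {H} \<and> \<Q> = \<P>"
  using assms(2,3,1)
  by (cases rule: rule.cases) (auto elim!: decomp.cases simp: repl_at_def)

text \<open>Replace \<open>H\<close> by \<open>X\<close> throughout. By uniqueness, a step with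
  \<open>H\<close> principal has \<open>X\<close> among its premises, and there \<open>X\<close> is
  already part of the context, so this premise is itself the conclusion sought.\<close>

lemma cum_invert:
  assumes "decomp H \<P>" and "X \<in> \<P>" and "cum S (insert H \<Sigma>)"
  shows "cum S (\<Sigma> \<union> X)"
proof -
  have "cum S (insert H \<Sigma> - {H} \<union> X)"
  proof (rule cum_replace[OF assms(3)])
    show "H \<noteq> Ante (Lab x (Atom p))" for x p
      using assms(1) by (auto elim: decomp.cases)
    show "cum S (insert (Ante (Lab x (Atom p))) X)" if "H = Succ (Lab x (Atom p))" for x p
      using assms(1) that by (auto elim: decomp.cases)
    show "cum S \<Sigma>'" if "rule S P \<Q>" "H \<in> P" "X \<subseteq> \<Sigma>'" "\<And>Y. Y \<in> \<Q> \<Longrightarrow> cum S (\<Sigma>' \<union> Y)"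
      for \<Sigma>' P \<Q>
      using decomp_unique_rule[OF assms(1) that(1,2)] that(3) that(4)[of X] assms(2)
      by (simp add: Un_absorb2)
  qed
  then show ?thesis by (rule cum_mono) auto
qed

text \<open>The constants make the cut reductions decrease: \<open>Cond A B\<close> at a label
  exceeds \<open>CondF\<close>, with summands 4 and 3, and \<open>CondF\<close> exceeds
  \<open>Fa c (Impl A B)\<close>, which contributes 2.\<close>

fun fwt :: "form \<Rightarrow> nat" where
  "fwt (Atom p) = 0"
| "fwt Bot = 0"
| "fwt (Conj A B) = fwt A + fwt B + 1"
| "fwt (Disj A B) = fwt A + fwt B + 1"
| "fwt (Impl A B) = fwt A + fwt B + 1"
| "fwt (Cond A B) = fwt A + fwt B + 4"

fun wt :: "lf \<Rightarrow> nat" where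
  "wt (Lab x A) = fwt A"
| "wt (Ex a A) = fwt A + 1"
| "wt (Fa a A) = fwt A + 1"
| "wt (CondF x a A B) = fwt A + fwt B + 3"
| "wt _ = 0"

text \<open>Base case of cut, used for succedent formulas. A formula that is never principal in a
  rule can matter only at an initial sequent, where the last assumption, the other cut premise,
  takes over.\<close>

lemma cum_drop_inert:
  assumes "cum S (insert H \<Sigma>)" and "\<And>P \<P>. rule S P \<P> \<Longrightarrow> H \<notin> P"
    and "\<And>x p. H \<noteq> Ante (Lab x (Atom p))"
    and "\<And>x p. H = Succ (Lab x (Atom p)) \<Longrightarrow> cum S (insert (Ante (Lab x (Atom p))) \<Sigma>)"
  shows "cum S \<Sigma>"
proof -
  have "cum S (insert H \<Sigma> - {H} \<union> \<Sigma>)"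
    by (rule cum_replace[OF assms(1,3,4)]) (use assms(2) in blast)+
  then show ?thesis by (rule cum_mono) auto
qed

text \<open>Replacing \<open>H\<close> by the whole context \<Sigma> hands over each step with
  \<open>H\<close> principal in a context that extends \<Sigma>, so the other cut premise remains
  available by weakening.\<close>

lemma cum_cut_principal:
  assumes "cum S (insert H \<Sigma>)" and "\<And>x p. H \<noteq> Ante (Lab x (Atom p))"
    and "\<And>x p. H \<noteq> Succ (Lab x (Atom p))"
    and "\<And>\<Sigma>' P \<P>. rule S P \<P> \<Longrightarrow> H \<in> P \<Longrightarrow> P - {H} \<subseteq> \<Sigma>' \<Longrightarrow> \<Sigma> \<subseteq> \<Sigma>' \<Longrightarrow>
      (\<And>X. X \<in> \<P> \<Longrightarrow> cum S (\<Sigma>' \<union> X)) \<Longrightarrow> cum S \<Sigma>'"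
  shows "cum S \<Sigma>"
proof -
  have "cum S (insert H \<Sigma> - {H} \<union> \<Sigma>)"
    by (rule cum_replace[OF assms(1,2)]) (use assms(3,4) in blast)+
  then show ?thesis by (rule cum_mono) auto
qed

inductive_cases ruleE: "rule S P \<P>"
inductive_cases decompE: "decomp H \<P>"

text \<open>One side is inverted, the other traversed. For \<open>Cond\<close> and \<open>Fa\<close>
  the antecedent side is traversed, for \<open>Ex\<close> and \<open>CondF\<close> the succedent
  side, because their rules there keep the principal formula and choose a label. For the
  propositional connectives both sides decompose.\<close>

lemma cum_cut:
  assumes "cum S (insert (Ante F) \<Sigma>)" and "cum S (insert (Succ F) \<Sigma>)"
  shows "cum S \<Sigma>"
  using assms
proof (induction F arbitrary: \<Sigma> rule: measure_induct_rule[of wt])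
  case (less F)
  \<comment> \<open>Cut on a lighter formula with weakening folded in, so that its premises may come
    from different contexts.\<close>
  have cut: "cum S \<Sigma>'"
    if "wt K < wt F" "cum S \<Sigma>1" "\<Sigma>1 \<subseteq> insert (Ante K) \<Sigma>'" "cum S \<Sigma>2" "\<Sigma>2 \<subseteq> insert (Succ K) \<Sigma>'"
    for K \<Sigma>' \<Sigma>1 \<Sigma>2
    using less.IH[OF that(1)] cum_mono[OF that(2,3)] cum_mono[OF that(4,5)] by blast
  have inv: "cum S (\<Sigma> \<union> X)" if "decomp H \<P>" "X \<in> \<P>" "H = Ante F \<or> H = Succ F" for H \<P> X
    using cum_invert[OF that(1,2), of S \<Sigma>] that(3) less.prems by blast
  have inert: ?case
    if "\<And>P \<P>. rule S P \<P> \<Longrightarrow> Succ F \<notin> P"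
    using that less.prems by (intro cum_drop_inert[OF less.prems(2)]) auto
  show ?case
  proof (cases F)
    case (InN a x)
    then show ?thesis by (intro inert) (auto elim!: ruleE decompE)
  next
    case (Mem x a)
    then show ?thesis by (intro inert) (auto elim!: ruleE decompE)
  next
    case (Sub a b)
    then show ?thesis by (intro inert) (auto elim!: ruleE decompE)
  next
    case (Lab x C)
    show ?thesis
    proof (cases C)
      case (Atom p)
      then show ?thesis using Lab by (intro inert) (auto elim!: ruleE decompE)
    next
      case Bot
      then show ?thesis using Lab by (intro inert) (auto elim!: ruleE decompE)
    next
      case (Conj A B)
      note F = Lab Conj
      have A: "cum S (\<Sigma> \<union> {Succ (Lab x A)})" and B: "cum S (\<Sigma> \<union> {Succ (Lab x B)})"
        by (rule inv[OF decomp.conjR[of x A B]]; simp add: F)+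
      show ?thesis
      proof (rule cum_cut_principal[OF less.prems(1)])
        fix \<Sigma>' P \<P>
        assume "rule S P \<P>" "Ante F \<in> P" and sub: "\<Sigma> \<subseteq> \<Sigma>'"
          and prem: "\<And>X. X \<in> \<P> \<Longrightarrow> cum S (\<Sigma>' \<union> X)"
        then have "\<P> = {{Ante (Lab x A), Ante (Lab x B)}}"
          using decomp_unique_rule[OF decomp.conjL[of x A B]] F by blast
        then have AB: "cum S (\<Sigma>' \<union> {Ante (Lab x A), Ante (Lab x B)})"
          using prem by blast
        have C: "cum S (insert (Ante (Lab x B)) \<Sigma>')"
          by (rule cut[OF _ AB _ A]) (use sub F in auto)
        show "cum S \<Sigma>'"
          by (rule cut[OF _ C _ B]) (use sub F in auto)
      qed (simp_all add: F)
    next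
      case (Disj A B)
      note F = Lab Disj
      have A: "cum S (\<Sigma> \<union> {Ante (Lab x A)})" and B: "cum S (\<Sigma> \<union> {Ante (Lab x B)})"
        by (rule inv[OF decomp.disjL[of x A B]]; simp add: F)+
      show ?thesis
      proof (rule cum_cut_principal[OF less.prems(2)])
        fix \<Sigma>' P \<P>
        assume "rule S P \<P>" "Succ F \<in> P" and sub: "\<Sigma> \<subseteq> \<Sigma>'"
          and prem: "\<And>X. X \<in> \<P> \<Longrightarrow> cum S (\<Sigma>' \<union> X)"
        then have "\<P> = {{Succ (Lab x A), Succ (Lab x B)}}"
          using decomp_unique_rule[OF decomp.disjR[of x A B]] F by blast
        then have AB: "cum S (\<Sigma>' \<union> {Succ (Lab x A), Succ (Lab x B)})"
          using prem by blast
        have C: "cum S (insert (Succ (Lab x B)) \<Sigma>')"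
          by (rule cut[OF _ A _ AB]) (use sub F in auto)
        show "cum S \<Sigma>'"
          by (rule cut[OF _ B _ C]) (use sub F in auto)
      qed (simp_all add: F)
    next
      case (Impl A B)
      note F = Lab Impl
      have AB: "cum S (\<Sigma> \<union> {Ante (Lab x A), Succ (Lab x B)})"
        by (rule inv[OF decomp.implR[of x A B]]; simp add: F)
      show ?thesis
      proof (rule cum_cut_principal[OF less.prems(1)])
        fix \<Sigma>' P \<P>
        assume "rule S P \<P>" "Ante F \<in> P" and sub: "\<Sigma> \<subseteq> \<Sigma>'"
          and prem: "\<And>X. X \<in> \<P> \<Longrightarrow> cum S (\<Sigma>' \<union> X)"
        then have "\<P> = {{Succ (Lab x A)}, {Ante (Lab x B)}}"
          using decomp_unique_rule[OF decomp.implL[of x A B]] F by blast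
        then have A: "cum S (\<Sigma>' \<union> {Succ (Lab x A)})" and B: "cum S (\<Sigma>' \<union> {Ante (Lab x B)})"
          using prem by blast+
        have C: "cum S (insert (Succ (Lab x B)) \<Sigma>')"
          by (rule cut[OF _ AB _ A]) (use sub F in auto)
        show "cum S \<Sigma>'"
          by (rule cut[OF _ B _ C]) (use sub F in auto)
      qed (simp_all add: F)
    next
      case (Cond A B)
      note F = Lab Cond
      have AB: "cum S (\<Sigma> \<union> {Ante (InN a x), Ante (Ex a A), Succ (CondF x a A B)})" for a
        by (rule inv[OF decomp.condR[of x A B]]; simp add: F)
      show ?thesis
      proof (rule cum_cut_principal[OF less.prems(1)])
        fix \<Sigma>' P \<P>
        assume "rule S P \<P>" "Ante F \<in> P" "P - {Ante F} \<subseteq> \<Sigma>'" and sub: "\<Sigma> \<subseteq> \<Sigma>'"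
          and prem: "\<And>X. X \<in> \<P> \<Longrightarrow> cum S (\<Sigma>' \<union> X)"
        then obtain a where a: "Ante (InN a x) \<in> \<Sigma>'"
          and "\<P> = {{Succ (Ex a A)}, {Ante (CondF x a A B)}}"
          using F by (auto elim!: ruleE decompE simp: repl_at_def)
        then have A: "cum S (\<Sigma>' \<union> {Succ (Ex a A)})" and B: "cum S (\<Sigma>' \<union> {Ante (CondF x a A B)})"
          using prem by blast+
        \<comment> \<open>Inversion gave an instance for every label. At the label \<open>a\<close>
          used by the traversed step, the atom \<open>InN a x\<close> is already in \<Sigma>', which
          leaves only cuts on \<open>Ex a A\<close> and then on
          \<open>CondF x a A B\<close>.\<close>
        have C: "cum S (insert (Succ (CondF x a A B)) \<Sigma>')"
          by (rule cut[OF _ AB[of a] _ A]) (use sub F a in auto)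
        show "cum S \<Sigma>'"
          by (rule cut[OF _ B _ C]) (use sub F in auto)
      qed (simp_all add: F)
    qed
  next
    case (Ex a A)
    note F = this
    have A: "cum S (\<Sigma> \<union> {Ante (Mem x a), Ante (Lab x A)})" for x
      by (rule inv[OF decomp.exL[of a A]]; simp add: F)
    show ?thesis
    proof (rule cum_cut_principal[OF less.prems(2)])
      fix \<Sigma>' P \<P>
      assume "rule S P \<P>" "Succ F \<in> P" "P - {Succ F} \<subseteq> \<Sigma>'" and sub: "\<Sigma> \<subseteq> \<Sigma>'"
        and prem: "\<And>X. X \<in> \<P> \<Longrightarrow> cum S (\<Sigma>' \<union> X)"
      then obtain x where x: "Ante (Mem x a) \<in> \<Sigma>'" and "\<P> = {{Succ (Lab x A)}}"
        using F by (auto elim!: ruleE decompE)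
      then have C: "cum S (\<Sigma>' \<union> {Succ (Lab x A)})"
        using prem by blast
      show "cum S \<Sigma>'"
        by (rule cut[OF _ A[of x] _ C]) (use sub F x in auto)
    qed (simp_all add: F)
  next
    case (Fa a A)
    note F = this
    have A: "cum S (\<Sigma> \<union> {Ante (Mem x a), Succ (Lab x A)})" for x
      by (rule inv[OF decomp.faR[of a A]]; simp add: F)
    show ?thesis
    proof (rule cum_cut_principal[OF less.prems(1)])
      fix \<Sigma>' P \<P>
      assume "rule S P \<P>" "Ante F \<in> P" "P - {Ante F} \<subseteq> \<Sigma>'" and sub: "\<Sigma> \<subseteq> \<Sigma>'"
        and prem: "\<And>X. X \<in> \<P> \<Longrightarrow> cum S (\<Sigma>' \<union> X)"
      then obtain x where x: "Ante (Mem x a) \<in> \<Sigma>'" and "\<P> = {{Ante (Lab x A)}}"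
        using F by (auto elim!: ruleE decompE simp: repl_at_def)
      then have C: "cum S (\<Sigma>' \<union> {Ante (Lab x A)})"
        using prem by blast
      show "cum S \<Sigma>'"
        by (rule cut[OF _ C _ A[of x]]) (use sub F x in auto)
    qed (simp_all add: F)
  next
    case (CondF x a A B)
    note F = this
    have AB: "cum S (\<Sigma> \<union> {Ante (InN c x), Ante (Sub c a), Ante (Ex c A), Ante (Fa c (Impl A B))})" for c
      by (rule inv[OF decomp.barL[of x a A B]]; simp add: F)
    show ?thesis
    proof (rule cum_cut_principal[OF less.prems(2)])
      fix \<Sigma>' P \<P>
      assume "rule S P \<P>" "Succ F \<in> P" "P - {Succ F} \<subseteq> \<Sigma>'" and sub: "\<Sigma> \<subseteq> \<Sigma>'"
        and prem: "\<And>X. X \<in> \<P> \<Longrightarrow> cum S (\<Sigma>' \<union> X)"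
      then obtain c where c: "Ante (InN c x) \<in> \<Sigma>'" "Ante (Sub c a) \<in> \<Sigma>'"
        and "\<P> = {{Succ (Ex c A)}, {Succ (Fa c (Impl A B))}}"
        using F by (auto elim!: ruleE decompE)
      then have A: "cum S (\<Sigma>' \<union> {Succ (Ex c A)})" and B: "cum S (\<Sigma>' \<union> {Succ (Fa c (Impl A B))})"
        using prem by blast+
      \<comment> \<open>Again the inverted premise is taken at the label \<open>c\<close> of the
        step, whose two relational atoms are present.\<close>
      have C: "cum S (insert (Ante (Fa c (Impl A B))) \<Sigma>')"
        by (rule cut[OF _ AB[of c] _ A]) (use sub F c in auto)
      show "cum S \<Sigma>'"
        by (rule cut[OF _ C _ B]) (use sub F in auto)
    qed (simp_all add: F)
  qed
qed

subsection \<open>From derivations to the cumulative calculus\<close>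

text \<open>Variables may be identified or sent to singletons. Such substitutions produce all
  instances of an eigenvariable premise from a single one.\<close>

fun subst_n :: "(wlab \<Rightarrow> wlab) \<Rightarrow> (nat \<Rightarrow> nlab) \<Rightarrow> nlab \<Rightarrow> nlab" where
  "subst_n f g (NV n) = g n"
| "subst_n f g (Sg x) = Sg (f x)"

fun subst :: "(wlab \<Rightarrow> wlab) \<Rightarrow> (nat \<Rightarrow> nlab) \<Rightarrow> lf \<Rightarrow> lf" where
  "subst f g (InN a x) = InN (subst_n f g a) (f x)"
| "subst f g (Mem x a) = Mem (f x) (subst_n f g a)"
| "subst f g (Sub a b) = Sub (subst_n f g a) (subst_n f g b)"
| "subst f g (Lab x A) = Lab (f x) A"
| "subst f g (Ex a A) = Ex (subst_n f g a) A"
| "subst f g (Fa a A) = Fa (subst_n f g a) A"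
| "subst f g (CondF x a A B) = CondF (f x) (subst_n f g a) A B"

lemma subst_n_upd_w [simp]: "x \<notin> wl_n a \<Longrightarrow> subst_n (f(x := y)) g a = subst_n f g a"
  by (cases a) auto

lemma subst_n_upd_n [simp]: "n \<notin> nv_n a \<Longrightarrow> subst_n f (g(n := b)) a = subst_n f g a"
  by (cases a) auto

lemma subst_upd_w: "x \<notin> wls F \<Longrightarrow> subst (f(x := y)) g F = subst f g F"
  by (cases F) auto

lemma subst_upd_n: "n \<notin> nvs F \<Longrightarrow> subst f (g(n := b)) F = subst f g F"
  by (cases F) auto

lemma subst_n_id [simp]: "subst_n id NV a = a"
  by (cases a) auto

lemma subst_id [simp]: "subst id NV F = F"
  by (cases F) auto

definition sq :: "(wlab \<Rightarrow> wlab) \<Rightarrow> (nat \<Rightarrow> nlab) \<Rightarrow> lf multiset \<Rightarrow> lf multiset \<Rightarrow> sf set" where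
  "sq f g G D = (\<lambda>F. Ante (subst f g F)) ` set_mset G \<union> (\<lambda>F. Succ (subst f g F)) ` set_mset D"

lemma sq_add_ante [simp]: "sq f g (add_mset F G) D = insert (Ante (subst f g F)) (sq f g G D)"
  by (auto simp: sq_def)

lemma sq_add_succ [simp]: "sq f g G (add_mset F D) = insert (Succ (subst f g F)) (sq f g G D)"
  by (auto simp: sq_def)

text \<open>This is what freshness provides: the value at the eigenvariable can be changed while the
  conclusion stays fixed.\<close>

lemma sq_upd_w: "x \<notin> wls_seq G D \<Longrightarrow> sq (f(x := y)) g G D = sq f g G D"
  unfolding sq_def wls_seq_def by (auto simp: subst_upd_w image_iff)

lemma sq_upd_n: "n \<notin> nvs_seq G D \<Longrightarrow> sq f (g(n := b)) G D = sq f g G D"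
  unfolding sq_def nvs_seq_def by (auto simp: subst_upd_n image_iff)

lemma wls_seq_add [simp]:
  "wls_seq (add_mset F G) D = wls F \<union> wls_seq G D"
  "wls_seq G (add_mset F D) = wls F \<union> wls_seq G D"
  by (auto simp: wls_seq_def)

lemma nvs_seq_add [simp]:
  "nvs_seq (add_mset F G) D = nvs F \<union> nvs_seq G D"
  "nvs_seq G (add_mset F D) = nvs F \<union> nvs_seq G D"
  by (auto simp: nvs_seq_def)

text \<open>Entries of \<open>remdups xs\<close> have multiplicity one, so the side condition of U1,
  U2 and A1 reduces to membership, the form in which the set calculus states it.\<close>

lemma mset_remdups_subset_iff: "mset (remdups xs) \<subseteq># G \<longleftrightarrow> set xs \<subseteq> set_mset G"
proof -
  have "count (mset (remdups xs)) F = (if F \<in> set xs then 1 else 0)" for F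
    using distinct_count_atmost_1[of "remdups xs"] by auto
  then show ?thesis
    by (auto simp: subseteq_mset_def Suc_le_eq)
qed

lemma repl_at_subst: "repl_at x y F F' \<Longrightarrow> repl_at (f x) (f y) (subst f g F) (subst f g F')"
  unfolding repl_at_def by auto


lemma sq_anteI: "F \<in># G \<Longrightarrow> Ante (subst f g F) \<in> sq f g G D"
  by (auto simp: sq_def)

text \<open>Quantifying over all substitutions drives the eigenvariable cases: the induction
  hypothesis at \<open>f(x := y)\<close> or \<open>g(n := c)\<close> yields the premise for an
  arbitrary label. In the other cases the same rule applies, up to weakening by its principal
  formulas.\<close>

lemma derivable_imp_cum:
  assumes "derivable S G D"
  shows "cum S (sq f g G D)"
  using assms
proof (induction arbitrary: f g rule: derivable.induct)
  case (init x p G D)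
  show ?case by (rule cum.init[of "f x" p]) auto
next
  case (botL x G D)
  show ?case by (rule cum.step[OF rule.decomp[OF decomp.botL[of "f x"]]]) auto
next
  case (conjL x A B G D)
  show ?case
    by (rule cum.step[OF rule.decomp[OF decomp.conjL[of "f x" A B]]])
      (auto intro: cum_mono[OF conjL.IH[of f g]])
next
  case (conjR G x A D B)
  show ?case
    by (rule cum.step[OF rule.decomp[OF decomp.conjR[of "f x" A B]]])
      (auto intro: cum_mono[OF conjR.IH(1)[of f g]] cum_mono[OF conjR.IH(2)[of f g]])
next
  case (disjL x A G D B)
  show ?case
    by (rule cum.step[OF rule.decomp[OF decomp.disjL[of "f x" A B]]])
      (auto intro: cum_mono[OF disjL.IH(1)[of f g]] cum_mono[OF disjL.IH(2)[of f g]])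
next
  case (disjR G x A B D)
  show ?case
    by (rule cum.step[OF rule.decomp[OF decomp.disjR[of "f x" A B]]])
      (auto intro: cum_mono[OF disjR.IH[of f g]])
next
  case (implL G x A D B)
  show ?case
    by (rule cum.step[OF rule.decomp[OF decomp.implL[of "f x" A B]]])
      (auto intro: cum_mono[OF implL.IH(1)[of f g]] cum_mono[OF implL.IH(2)[of f g]])
next
  case (implR x A G B D)
  show ?case
    by (rule cum.step[OF rule.decomp[OF decomp.implR[of "f x" A B]]])
      (auto intro: cum_mono[OF implR.IH[of f g]])
next
  case (faL x A a G D)
  show ?case
    by (rule cum.step[OF rule.faL[of S "f x" "subst_n f g a" A]])
      (auto intro: cum_mono[OF faL.IH[of f g]])
next
  case (faR x G a A D)
  have *: "cum S (insert (Ante (Mem y (subst_n f g a))) (insert (Succ (Lab y A)) (sq f g G D)))" for y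
    using faR.IH[of "f(x := y)" g] faR.hyps by (simp add: sq_upd_w insert_commute fun_upd_same fun_upd_other del: fun_upd_apply)
  show ?case
    by (rule cum.step[OF rule.decomp[OF decomp.faR[of "subst_n f g a" A]]])
      (auto intro: cum_mono[OF *])
next
  case (exL x a A G D)
  have *: "cum S (insert (Ante (Mem y (subst_n f g a))) (insert (Ante (Lab y A)) (sq f g G D)))" for y
    using exL.IH[of "f(x := y)" g] exL.hyps by (simp add: sq_upd_w insert_commute fun_upd_same fun_upd_other del: fun_upd_apply)
  show ?case
    by (rule cum.step[OF rule.decomp[OF decomp.exL[of "subst_n f g a" A]]])
      (auto intro: cum_mono[OF *])
next
  case (exR x a G A D)
  show ?case
    by (rule cum.step[OF rule.exR[of S "f x" "subst_n f g a" A]])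
      (auto intro: cum_mono[OF exR.IH[of f g]])
next
  case (condR n G x A B D)
  have *: "cum S (insert (Ante (InN c (f x))) (insert (Ante (Ex c A))
      (insert (Succ (CondF (f x) c A B)) (sq f g G D))))" for c
    using condR.IH[of f "g(n := c)"] condR.hyps by (simp add: sq_upd_n insert_commute fun_upd_same fun_upd_other del: fun_upd_apply)
  show ?case
    by (rule cum.step[OF rule.decomp[OF decomp.condR[of "f x" A B]]])
      (auto intro: cum_mono[OF *])
next
  case (condL a x A B G D)
  show ?case
    by (rule cum.step[OF rule.condL[of S "subst_n f g a" "f x" A B]])
      (auto intro: cum_mono[OF condL.IH(1)[of f g]] cum_mono[OF condL.IH(2)[of f g]])
next
  case (barR c x a G A B D)
  show ?case
    by (rule cum.step[OF rule.barR[of S "subst_n f g c" "f x" "subst_n f g a" A B]])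
      (auto intro: cum_mono[OF barR.IH(1)[of f g]] cum_mono[OF barR.IH(2)[of f g]])
next
  case (barL n x a A B G D)
  have *: "cum S (insert (Ante (InN c (f x))) (insert (Ante (Sub c (subst_n f g a)))
      (insert (Ante (Ex c A)) (insert (Ante (Fa c (Impl A B))) (sq f g G D)))))" for c
    using barL.IH[of f "g(n := c)"] barL.hyps by (simp add: sq_upd_n insert_commute fun_upd_same fun_upd_other del: fun_upd_apply)
  show ?case
    by (rule cum.step[OF rule.decomp[OF decomp.barL[of "f x" "subst_n f g a" A B]]])
      (auto intro: cum_mono[OF *])
next
  case (refl a G D)
  show ?case
    by (rule cum.step[OF rule.refl[of S "subst_n f g a"]])
      (auto intro: cum_mono[OF refl.IH[of f g]])
next
  case (trans c a b G D)
  show ?case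
    by (rule cum.step[OF rule.trans[of S "subst_n f g c" "subst_n f g b" "subst_n f g a"]])
      (auto intro: cum_mono[OF trans.IH[of f g]])
next
  case (subL x a b G D)
  show ?case
    by (rule cum.step[OF rule.subL[of S "f x" "subst_n f g a" "subst_n f g b"]])
      (auto intro: cum_mono[OF subL.IH[of f g]])
next
  case (ruleN n G D x)
  have *: "cum S (insert (Ante (InN c (f x))) (sq f g G D))" for c
    using ruleN.IH[of f "g(n := c)"] ruleN.hyps by (simp add: sq_upd_n fun_upd_same fun_upd_other del: fun_upd_apply)
  show ?case
    by (rule cum.step[OF rule.ruleN[OF ruleN.hyps(1), of "f x"]]) (auto intro: cum_mono[OF *])
next
  case (rule0 y a x G D)
  have *: "cum S (insert (Ante (Mem z (subst_n f g a)))
      (insert (Ante (InN (subst_n f g a) (f x))) (sq f g G D)))" for z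
    using rule0.IH[of "f(y := z)" g] rule0.hyps by (simp add: sq_upd_w fun_upd_same fun_upd_other del: fun_upd_apply)
  show ?case
    by (rule cum.step[OF rule.rule0[OF rule0.hyps(1), of "subst_n f g a" "f x"]])
      (auto intro: cum_mono[OF *])
next
  case (ruleT n G D x)
  have *: "cum S (insert (Ante (Mem (f x) c)) (insert (Ante (InN c (f x))) (sq f g G D)))" for c
    using ruleT.IH[of f "g(n := c)"] ruleT.hyps by (simp add: sq_upd_n fun_upd_same fun_upd_other del: fun_upd_apply)
  show ?case
    by (rule cum.step[OF rule.ruleT[OF ruleT.hyps(1), of "f x"]]) (auto intro: cum_mono[OF *])
next
  case (ruleW x a G D)
  show ?case
    by (rule cum.step[OF rule.ruleW[OF ruleW.hyps(1), of "subst_n f g a" "f x"]])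
      (auto intro: cum_mono[OF ruleW.IH[of f g]])
next
  case (ruleSingle x G D)
  show ?case
    by (rule cum.step[OF rule.ruleSingle[OF ruleSingle.hyps(1), of "f x"]])
      (auto intro: cum_mono[OF ruleSingle.IH[of f g]])
next
  case (ruleC x a G D)
  show ?case
    by (rule cum.step[OF rule.ruleC[OF ruleC.hyps(1), of "subst_n f g a" "f x"]])
      (auto intro: cum_mono[OF ruleC.IH[of f g]])
next
  case (repl1 x y F F' G D)
  show ?case
    by (rule cum.step[OF rule.repl1[OF repl1.hyps(1) repl_at_subst[OF repl1.hyps(2), of f g]]])
      (auto intro: cum_mono[OF repl1.IH[of f g]])
next
  case (repl2 x y F F' G D)
  show ?case
    by (rule cum.step[OF rule.repl2[OF repl2.hyps(1) repl_at_subst[OF repl2.hyps(2), of f g]]])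
      (auto intro: cum_mono[OF repl2.IH[of f g]])
next
  case (ruleU1 a x y b z G n D)
  have *: "cum S (insert (Ante (Mem (f z) c)) (insert (Ante (InN c (f x))) (sq f g G D)))" for c
    using ruleU1.IH[of f "g(n := c)"] ruleU1.hyps by (simp add: sq_upd_n fun_upd_same fun_upd_other del: fun_upd_apply)
  have mem: "InN a x \<in># G" "Mem y a \<in># G" "InN b y \<in># G" "Mem z b \<in># G"
    using ruleU1.hyps(2) unfolding mset_remdups_subset_iff by simp_all
  show ?case
    by (rule cum.step[OF rule.ruleU1[OF ruleU1.hyps(1),
            of "subst_n f g a" "f x" "f y" "subst_n f g b" "f z"]])
      (use mem[THEN sq_anteI, of f g D] in \<open>auto intro: cum_mono[OF *]\<close>)
next
  case (ruleU2 a x y b z G n D)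
  have *: "cum S (insert (Ante (Mem (f z) c)) (insert (Ante (InN c (f y))) (sq f g G D)))" for c
    using ruleU2.IH[of f "g(n := c)"] ruleU2.hyps by (simp add: sq_upd_n fun_upd_same fun_upd_other del: fun_upd_apply)
  have mem: "InN a x \<in># G" "Mem y a \<in># G" "InN b x \<in># G" "Mem z b \<in># G"
    using ruleU2.hyps(2) unfolding mset_remdups_subset_iff by simp_all
  show ?case
    by (rule cum.step[OF rule.ruleU2[OF ruleU2.hyps(1),
            of "subst_n f g a" "f x" "f y" "subst_n f g b" "f z"]])
      (use mem[THEN sq_anteI, of f g D] in \<open>auto intro: cum_mono[OF *]\<close>)
next
  case (ruleA1 a x y b G D)
  have mem: "InN a x \<in># G" "Mem y a \<in># G" "InN b x \<in># G"
    using ruleA1.hyps(2) unfolding mset_remdups_subset_iff by simp_all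
  show ?case
    by (rule cum.step[OF rule.ruleA1[OF ruleA1.hyps(1),
            of "subst_n f g a" "f x" "f y" "subst_n f g b"]])
      (use mem[THEN sq_anteI, of f g D] in \<open>auto intro: cum_mono[OF ruleA1.IH[of f g]]\<close>)
next
  case (ruleA2 b x a y G D)
  show ?case
    by (rule cum.step[OF rule.ruleA2[OF ruleA2.hyps(1),
            of "subst_n f g a" "f x" "f y" "subst_n f g b"]])
      (auto intro: cum_mono[OF ruleA2.IH[of f g]])
qed

subsection \<open>From the cumulative calculus to derivations\<close>

text \<open>For an eigenvariable rule, the \<open>X\<close> in \<open>parts\<close> is the one
  instance whose label was actually introduced.\<close>

inductive cov :: "lf multiset \<Rightarrow> lf multiset \<Rightarrow> sf \<Rightarrow> bool" for G D where
  ante: "F \<in># G \<Longrightarrow> cov G D (Ante F)"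
| succ: "F \<in># D \<Longrightarrow> cov G D (Succ F)"
| parts: "decomp H \<P> \<Longrightarrow> X \<in> \<P> \<Longrightarrow> (\<And>K. K \<in> X \<Longrightarrow> cov G D K) \<Longrightarrow> cov G D H"

definition covs :: "lf multiset \<Rightarrow> lf multiset \<Rightarrow> lf multiset \<Rightarrow> lf multiset \<Rightarrow> bool" where
  "covs G' D' G D \<longleftrightarrow> (\<forall>F\<in>#G. cov G' D' (Ante F)) \<and> (\<forall>F\<in>#D. cov G' D' (Succ F))"

text \<open>Everything accumulated on a cumulative branch thus stays covered after later rules have
  consumed formulas of the sequent.\<close>

lemma cov_trans: "cov G D H \<Longrightarrow> covs G' D' G D \<Longrightarrow> cov G' D' H"
  by (induction rule: cov.induct) (auto simp: covs_def intro: cov.parts)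

lemma covs_mono: "G \<subseteq># G' \<Longrightarrow> D \<subseteq># D' \<Longrightarrow> covs G' D' G D"
  by (auto simp: covs_def intro: cov.intros dest: mset_subset_eqD)

text \<open>Undecomposable formulas can be covered only by occurring. They include all principal
  formulas of the rules outside \<open>decomp\<close> and of initial sequents, so those rules can be
  applied literally.\<close>

lemma cov_mem:
  "cov G D (Ante (InN a x)) \<Longrightarrow> InN a x \<in># G"
  "cov G D (Ante (Mem x a)) \<Longrightarrow> Mem x a \<in># G"
  "cov G D (Ante (Sub a b)) \<Longrightarrow> Sub a b \<in># G"
  "cov G D (Ante (Lab x (Atom p))) \<Longrightarrow> Lab x (Atom p) \<in># G"
  "cov G D (Ante (Lab x (Cond A B))) \<Longrightarrow> Lab x (Cond A B) \<in># G"
  "cov G D (Ante (Fa a A)) \<Longrightarrow> Fa a A \<in># G"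
  "cov G D (Succ (Lab x (Atom p))) \<Longrightarrow> Lab x (Atom p) \<in># D"
  "cov G D (Succ (Ex a A)) \<Longrightarrow> Ex a A \<in># D"
  "cov G D (Succ (CondF x a A B)) \<Longrightarrow> CondF x a A B \<in># D"
  by (erule cov.cases; auto elim: decompE)+

lemma fresh_wls: "\<exists>x. x \<notin> wls_seq G D"
proof -
  have "finite (wl_n a)" for a by (cases a) auto
  then have "finite (wls F)" for F by (cases F) auto
  then have "finite (wls_seq G D)" by (auto simp: wls_seq_def)
  then show ?thesis by (rule ex_new_if_finite[OF infinite_UNIV_nat])
qed

lemma fresh_nvs: "\<exists>n. n \<notin> nvs_seq G D"
proof -
  have "finite (nv_n a)" for a by (cases a) auto
  then have "finite (nvs F)" for F by (cases F) auto
  then have "finite (nvs_seq G D)" by (auto simp: nvs_seq_def)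
  then show ?thesis by (rule ex_new_if_finite[OF infinite_UNIV_nat])
qed

text \<open>A backward application of a consuming rule loses \<open>F\<close>, but the parts it
  leaves behind still cover \<open>F\<close>.\<close>

lemma covs_replace_ante:
  assumes "decomp (Ante F) \<P>" and "X \<in> \<P>" and "\<And>K. K \<in> X \<Longrightarrow> cov G' D' K"
    and "G \<subseteq># G'" and "D \<subseteq># D'"
  shows "covs G' D' (add_mset F G) D"
  using covs_mono[OF assms(4,5)] cov.parts[OF assms(1,2,3)] by (auto simp: covs_def)

lemma covs_replace_succ:
  assumes "decomp (Succ F) \<P>" and "X \<in> \<P>" and "\<And>K. K \<in> X \<Longrightarrow> cov G' D' K"
    and "G \<subseteq># G'" and "D \<subseteq># D'"
  shows "covs G' D' G (add_mset F D)"
  using covs_mono[OF assms(4,5)] cov.parts[OF assms(1,2,3)] by (auto simp: covs_def)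

lemma subset_add_mset2 [simp]: "G \<subseteq># G' \<Longrightarrow> G \<subseteq># add_mset F G'"
  by (metis add_mset_add_single mset_subset_eq_add_left subset_mset.order_trans)

lemma derivable_decomp_ante:
  assumes "decomp (Ante F) \<P>"
    and prem: "\<And>X G' D'. X \<in> \<P> \<Longrightarrow> covs G' D' (add_mset F G) D \<Longrightarrow> (\<And>K. K \<in> X \<Longrightarrow> cov G' D' K)
      \<Longrightarrow> derivable S G' D'"
  shows "derivable S (add_mset F G) D"
proof -
  have prem': "derivable S G' D'"
    if "X \<in> \<P>" "\<And>K. K \<in> X \<Longrightarrow> cov G' D' K" "G \<subseteq># G'" "D \<subseteq># D'" for X G' D'
    using prem[OF that(1) covs_replace_ante[OF assms(1) that]] that(2) by blast
  from assms(1) show ?thesis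
  proof cases
    case (botL x)
    then show ?thesis by (simp add: derivable.botL)
  next
    case (conjL x A B)
    show ?thesis unfolding conjL
      by (rule derivable.conjL, rule prem'[of "{Ante (Lab x A), Ante (Lab x B)}"])
        (auto simp: conjL intro: cov.intros)
  next
    case (disjL x A B)
    show ?thesis unfolding disjL
      by (rule derivable.disjL, rule prem'[of "{Ante (Lab x A)}"], simp_all add: disjL cov.intros,
          rule prem'[of "{Ante (Lab x B)}"], simp_all add: disjL cov.intros)
  next
    case (implL x A B)
    show ?thesis unfolding implL
      by (rule derivable.implL, rule prem'[of "{Succ (Lab x A)}"], simp_all add: implL cov.intros,
          rule prem'[of "{Ante (Lab x B)}"], simp_all add: implL cov.intros)
  next
    case (exL a A)
    \<comment> \<open>Of the infinitely many premises only the one at a fresh label is used; the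
      finitary rule asks for no more.\<close>
    obtain x where x: "x \<notin> wls_seq (add_mset (Ex a A) G) D" using fresh_wls by blast
    show ?thesis unfolding exL
      by (rule derivable.exL[OF x], rule prem'[of "{Ante (Mem x a), Ante (Lab x A)}"])
        (auto simp: exL intro: cov.intros)
  next
    case (barL x a A B)
    obtain n where n: "n \<notin> nvs_seq (add_mset (CondF x a A B) G) D" using fresh_nvs by blast
    show ?thesis unfolding barL
      by (rule derivable.barL[OF n], rule prem'[of "{Ante (InN (NV n) x), Ante (Sub (NV n) a),
            Ante (Ex (NV n) A), Ante (Fa (NV n) (Impl A B))}"])
        (auto simp: barL intro: cov.intros)
  qed
qed

lemma derivable_decomp_succ:
  assumes "decomp (Succ F) \<P>"
    and prem: "\<And>X G' D'. X \<in> \<P> \<Longrightarrow> covs G' D' G (add_mset F D) \<Longrightarrow> (\<And>K. K \<in> X \<Longrightarrow> cov G' D' K)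
      \<Longrightarrow> derivable S G' D'"
  shows "derivable S G (add_mset F D)"
proof -
  have prem': "derivable S G' D'"
    if "X \<in> \<P>" "\<And>K. K \<in> X \<Longrightarrow> cov G' D' K" "G \<subseteq># G'" "D \<subseteq># D'" for X G' D'
    using prem[OF that(1) covs_replace_succ[OF assms(1) that]] that(2) by blast
  from assms(1) show ?thesis
  proof cases
    case (conjR x A B)
    show ?thesis unfolding conjR
      by (rule derivable.conjR, rule prem'[of "{Succ (Lab x A)}"], simp_all add: conjR cov.intros,
          rule prem'[of "{Succ (Lab x B)}"], simp_all add: conjR cov.intros)
  next
    case (disjR x A B)
    show ?thesis unfolding disjR
      by (rule derivable.disjR, rule prem'[of "{Succ (Lab x A), Succ (Lab x B)}"])
        (auto simp: disjR intro: cov.intros)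
  next
    case (implR x A B)
    show ?thesis unfolding implR
      by (rule derivable.implR, rule prem'[of "{Ante (Lab x A), Succ (Lab x B)}"])
        (auto simp: implR intro: cov.intros)
  next
    case (faR a A)
    obtain x where x: "x \<notin> wls_seq G (add_mset (Fa a A) D)" using fresh_wls by blast
    show ?thesis unfolding faR
      by (rule derivable.faR[OF x], rule prem'[of "{Ante (Mem x a), Succ (Lab x A)}"])
        (auto simp: faR intro: cov.intros)
  next
    case (condR x A B)
    obtain n where n: "n \<notin> nvs_seq G (add_mset (Lab x (Cond A B)) D)" using fresh_nvs by blast
    show ?thesis unfolding condR
      by (rule derivable.condR[OF n], rule prem'[of "{Ante (InN (NV n) x), Ante (Ex (NV n) A),
            Succ (CondF x (NV n) A B)}"])
        (auto simp: condR intro: cov.intros)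
  qed
qed

text \<open>Supplies the two occurrences that a two-premise-atom multiset pattern demands. Equal
  principal atoms are treated separately where they can arise.\<close>

lemma two_members:
  assumes "F \<in># G" and "K \<in># G" and "F \<noteq> K"
  shows "\<exists>G'. G = add_mset F (add_mset K G')"
  using assms by (metis insert_DiffM insert_noteq_member)

lemma cum_imp_derivable:
  assumes "cum S \<Sigma>" and "\<And>H. H \<in> \<Sigma> \<Longrightarrow> cov G D H"
  shows "derivable S G D"
  using assms
proof (induction arbitrary: G D rule: cum.induct)
  case (init x p \<Sigma>)
  then have "Lab x (Atom p) \<in># G" "Lab x (Atom p) \<in># D"
    by (auto dest: cov_mem)
  then show ?case by (metis derivable.init insert_DiffM)
next
  case (step P \<P> \<Sigma>)
  \<comment> \<open>The induction hypothesis for any sequent that covers the present one together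
    with the formulas of a premise; \<open>grow\<close> below is the case where nothing is
    consumed.\<close>
  have prem: "derivable S G' D'"
    if "X \<in> \<P>" "covs G' D' G D" "\<And>K. K \<in> X \<Longrightarrow> cov G' D' K" for X G' D'
    by (rule step.IH[OF that(1)]) (use step.prems cov_trans that in blast)
  have grow: "derivable S G' D'"
    if "X \<in> \<P>" "X \<subseteq> Ante ` set_mset G' \<union> Succ ` set_mset D'" "G \<subseteq># G'" "D \<subseteq># D'" for X G' D'
    by (rule prem[OF that(1) covs_mono[OF that(3,4)]]) (use that(2) in \<open>auto intro: cov.intros\<close>)
  have P: "H \<in> P \<Longrightarrow> cov G D H" for H
    using step.hyps(2) step.prems by blast
  from step.hyps(1) show ?case
  proof cases
    case (decomp H)
    then have "cov G D H" using P by simp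
    then show ?thesis
    proof cases
      case (ante F)
      then obtain G' where G: "G = add_mset F G'" by (metis insert_DiffM)
      show ?thesis unfolding G
        by (rule derivable_decomp_ante[of F \<P>]) (use decomp ante prem G in blast)+
    next
      case (succ F)
      then obtain D' where D: "D = add_mset F D'" by (metis insert_DiffM)
      show ?thesis unfolding D
        by (rule derivable_decomp_succ[of F \<P>]) (use decomp succ prem D in blast)+
    next
      \<comment> \<open>The formula was decomposed earlier. By uniqueness, the \<open>X\<close>
        covered then is also a premise of this step, so the induction hypothesis applies to the
        unchanged sequent and no rule is used.\<close>
      case (parts \<Q> X)
      then have "\<Q> = \<P>"
        using decomp_unique_rule[OF decomp(2) rule.decomp] by blast
      then show ?thesis using prem[of X G D] parts covs_mono by blast
    qed
  next
    case (faL x a A)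
    then have "Mem x a \<in># G" "Fa a A \<in># G" using P by (auto dest: cov_mem)
    then obtain G' where G: "G = add_mset (Mem x a) (add_mset (Fa a A) G')"
      using two_members[of "Mem x a" G "Fa a A"] by auto
    show ?thesis unfolding G
      by (rule derivable.faL, rule grow) (auto simp: faL G)
  next
    case (exR x a A)
    then have "Mem x a \<in># G" "Ex a A \<in># D" using P by (auto dest: cov_mem)
    then obtain G' D' where G: "G = add_mset (Mem x a) G'" "D = add_mset (Ex a A) D'"
      by (metis insert_DiffM)
    show ?thesis unfolding G
      by (rule derivable.exR, rule grow) (auto simp: exR G)
  next
    case (condL a x A B)
    then have "InN a x \<in># G" "Lab x (Cond A B) \<in># G" using P by (auto dest: cov_mem)
    then obtain G' where G: "G = add_mset (InN a x) (add_mset (Lab x (Cond A B)) G')"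
      using two_members[of "InN a x" G "Lab x (Cond A B)"] by auto
    show ?thesis unfolding G
    proof (rule derivable.condL)
      show "derivable S (add_mset (InN a x) (add_mset (Lab x (Cond A B)) G')) (add_mset (Ex a A) D)"
        by (rule grow[of "{Succ (Ex a A)}"]) (auto simp: condL G)
      show "derivable S (add_mset (CondF x a A B)
          (add_mset (InN a x) (add_mset (Lab x (Cond A B)) G'))) D"
        by (rule grow[of "{Ante (CondF x a A B)}"]) (auto simp: condL G)
    qed
  next
    case (barR c x a A B)
    then have "InN c x \<in># G" "Sub c a \<in># G" and "CondF x a A B \<in># D"
      using P by (auto dest: cov_mem)
    then obtain G' D' where G: "G = add_mset (InN c x) (add_mset (Sub c a) G')"
      and D: "D = add_mset (CondF x a A B) D'"
      using two_members[of "InN c x" G "Sub c a"] multi_member_split[of "CondF x a A B" D] by auto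
    show ?thesis unfolding G D
    proof (rule derivable.barR)
      show "derivable S (add_mset (InN c x) (add_mset (Sub c a) G'))
          (add_mset (CondF x a A B) (add_mset (Ex c A) D'))"
        by (rule grow[of "{Succ (Ex c A)}"]) (auto simp: barR G D)
      show "derivable S (add_mset (InN c x) (add_mset (Sub c a) G'))
          (add_mset (CondF x a A B) (add_mset (Fa c (Impl A B)) D'))"
        by (rule grow[of "{Succ (Fa c (Impl A B))}"]) (auto simp: barR G D)
    qed
  next
    case (refl a)
    show ?thesis
      by (rule derivable.refl[of _ a], rule grow) (auto simp: refl)
  next
    case (trans c b a)
    then have mem: "Sub c b \<in># G" "Sub b a \<in># G" using P by (auto dest: cov_mem)
    show ?thesis
    proof (cases "Sub c b = Sub b a")
      \<comment> \<open>Equality forces all three labels to coincide, so the atom to be added is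
        already there.\<close>
      case True
      then show ?thesis using mem grow[of "{Ante (Sub c a)}" G D] by (simp add: trans)
    next
      case False
      then obtain G' where G: "G = add_mset (Sub c b) (add_mset (Sub b a) G')"
        using two_members[OF mem] by blast
      show ?thesis unfolding G
        by (rule derivable.trans, rule grow) (auto simp: trans G)
    qed
  next
    case (subL x a b)
    then have "Mem x a \<in># G" "Sub a b \<in># G" using P by (auto dest: cov_mem)
    then obtain G' where G: "G = add_mset (Mem x a) (add_mset (Sub a b) G')"
      using two_members[of "Mem x a" G "Sub a b"] by auto
    show ?thesis unfolding G
      by (rule derivable.subL, rule grow) (auto simp: subL G)
  next
    case (ruleN x)
    obtain n where n: "n \<notin> nvs_seq G D" using fresh_nvs by blast
    show ?thesis
      by (rule derivable.ruleN[OF ruleN(3) n, of x], rule grow[of "{Ante (InN (NV n) x)}"])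
        (auto simp: ruleN)
  next
    case (rule0 a x)
    then have "InN a x \<in># G" using P by (auto dest: cov_mem)
    then obtain G' where G: "G = add_mset (InN a x) G'" by (metis insert_DiffM)
    obtain y where y: "y \<notin> wls_seq (add_mset (InN a x) G') D" using fresh_wls by blast
    show ?thesis unfolding G
      by (rule derivable.rule0[OF rule0(3) y], rule grow[of "{Ante (Mem y a)}"])
        (auto simp: rule0 G)
  next
    case (ruleT x)
    obtain n where n: "n \<notin> nvs_seq G D" using fresh_nvs by blast
    show ?thesis
      by (rule derivable.ruleT[OF ruleT(3) n, of x],
          rule grow[of "{Ante (Mem x (NV n)), Ante (InN (NV n) x)}"])
        (auto simp: ruleT)
  next
    case (ruleW a x)
    then have "InN a x \<in># G" using P by (auto dest: cov_mem)
    then obtain G' where G: "G = add_mset (InN a x) G'" by (metis insert_DiffM)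
    show ?thesis unfolding G
      by (rule derivable.ruleW[OF ruleW(3)], rule grow) (auto simp: ruleW G)
  next
    case (ruleSingle x)
    then have "InN (Sg x) x \<in># G" using P by (auto dest: cov_mem)
    then obtain G' where G: "G = add_mset (InN (Sg x) x) G'" by (metis insert_DiffM)
    show ?thesis unfolding G
      by (rule derivable.ruleSingle[OF ruleSingle(3)], rule grow) (auto simp: ruleSingle G)
  next
    case (ruleC a x)
    then have "InN a x \<in># G" using P by (auto dest: cov_mem)
    then obtain G' where G: "G = add_mset (InN a x) G'" by (metis insert_DiffM)
    show ?thesis unfolding G
      by (rule derivable.ruleC[OF ruleC(3)], rule grow) (auto simp: ruleC G)
  next
    case (repl1 x y F F')
    then have mem: "Mem y (Sg x) \<in># G" "F \<in># G"
      using P by (auto dest: cov_mem simp: repl_at_def)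
    show ?thesis
    proof (cases "Mem y (Sg x) = F")
      \<comment> \<open>Here \<open>x\<close> and \<open>y\<close> coincide, so this replacement
        adds nothing new.\<close>
      case True
      then have "F' = F" using repl1 by (auto simp: repl_at_def)
      then show ?thesis using mem grow[of "{Ante F'}" G D] by (simp add: repl1)
    next
      case False
      then obtain G' where G: "G = add_mset (Mem y (Sg x)) (add_mset F G')"
        using two_members[OF mem] by blast
      show ?thesis unfolding G
        by (rule derivable.repl1[OF repl1(3,4)], rule grow) (auto simp: repl1 G)
    qed
  next
    case (repl2 x y F F')
    then have mem: "Mem y (Sg x) \<in># G" "F' \<in># G"
      using P by (auto dest: cov_mem simp: repl_at_def)
    show ?thesis
    proof (cases "Mem y (Sg x) = F'")
      case True
      \<comment> \<open>This instance of Repl2 is not closed under contraction, but the atom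
        \<open>x \<in> {x}\<close> that it introduces is available in any case by T, C and Single.\<close>
      then have F: "F = Mem x (Sg x)" using repl2 by (auto simp: repl_at_def)
      have T: "hasT S" using repl2(3) by (cases S) auto
      obtain n where n: "n \<notin> nvs_seq G D" using fresh_nvs by blast
      have "derivable S (add_mset (Mem x (Sg x)) (add_mset (InN (Sg x) x)
          (add_mset (Sub (Sg x) (NV n)) (add_mset (InN (NV n) x) (add_mset (Mem x (NV n)) G))))) D"
        by (rule grow) (auto simp: repl2 F)
      then have "derivable S (add_mset (InN (Sg x) x)
          (add_mset (Sub (Sg x) (NV n)) (add_mset (InN (NV n) x) (add_mset (Mem x (NV n)) G)))) D"
        by (rule derivable.ruleSingle[OF repl2(3)])
      then have "derivable S (add_mset (InN (NV n) x) (add_mset (Mem x (NV n)) G)) D"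
        by (rule derivable.ruleC[OF repl2(3)])
      then show ?thesis
        by (intro derivable.ruleT[OF T n, of x]) (simp add: add_mset_commute)
    next
      case False
      then obtain G' where G: "G = add_mset (Mem y (Sg x)) (add_mset F' G')"
        using two_members[OF mem] by blast
      show ?thesis unfolding G
        by (rule derivable.repl2[OF repl2(3,4)], rule grow) (auto simp: repl2 G)
    qed
  next
    case (ruleU1 a x y b z)
    \<comment> \<open>Stated via \<open>remdups\<close>, the rule covers coinciding principal atoms,
      so no case distinction arises as it does for Tr.\<close>
    then have mem: "mset (remdups [InN a x, Mem y a, InN b y, Mem z b]) \<subseteq># G"
      unfolding mset_remdups_subset_iff using P by (auto dest: cov_mem)
    obtain n where n: "n \<notin> nvs_seq G D" using fresh_nvs by blast
    show ?thesis
      by (rule derivable.ruleU1[OF ruleU1(3) mem n],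
          rule grow[of "{Ante (Mem z (NV n)), Ante (InN (NV n) x)}"])
        (auto simp: ruleU1)
  next
    case (ruleU2 a x y b z)
    then have mem: "mset (remdups [InN a x, Mem y a, InN b x, Mem z b]) \<subseteq># G"
      unfolding mset_remdups_subset_iff using P by (auto dest: cov_mem)
    obtain n where n: "n \<notin> nvs_seq G D" using fresh_nvs by blast
    show ?thesis
      by (rule derivable.ruleU2[OF ruleU2(3) mem n],
          rule grow[of "{Ante (Mem z (NV n)), Ante (InN (NV n) y)}"])
        (auto simp: ruleU2)
  next
    case (ruleA1 a x y b)
    then have mem: "mset (remdups [InN a x, Mem y a, InN b x]) \<subseteq># G"
      unfolding mset_remdups_subset_iff using P by (auto dest: cov_mem)
    show ?thesis
      by (rule derivable.ruleA1[OF ruleA1(3) mem], rule grow) (auto simp: ruleA1)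
  next
    case (ruleA2 a x y b)
    then have mem: "InN a x \<in># G" "Mem y a \<in># G" "InN b y \<in># G"
      using P by (auto dest: cov_mem)
    show ?thesis
    proof (cases "InN a x = InN b y")
      \<comment> \<open>Then \<open>a = b\<close> and \<open>x = y\<close>, and
        \<open>InN b x\<close> already occurs. This is the only possible coincidence, since
        \<open>Mem y a\<close> differs from both other atoms.\<close>
      case True
      then show ?thesis using mem grow[of "{Ante (InN b x)}" G D] by (simp add: ruleA2)
    next
      case False
      obtain G1 where G1: "G = add_mset (Mem y a) G1" using mem by (metis insert_DiffM)
      then have "InN a x \<in># G1" "InN b y \<in># G1" using mem by auto
      then obtain G' where "G1 = add_mset (InN a x) (add_mset (InN b y) G')"
        using two_members[OF _ _ False] by auto
      then have G: "G = add_mset (InN a x) (add_mset (Mem y a) (add_mset (InN b y) G'))"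
        using G1 by (simp add: add_mset_commute)
      show ?thesis unfolding G
        by (rule derivable.ruleA2[OF ruleA2(3)], rule grow) (auto simp: ruleA2 G)
    qed
  qed
qed

theorem mainTheorem12:
  fixes S :: calc and F :: lf and G D G' D' :: "lf multiset"
  assumes "derivable S G (add_mset F D)"
      and "derivable S (add_mset F G') D'"
  shows "derivable S (G + G') (D + D')"
proof (rule cum_imp_derivable)
  \<comment> \<open>Under the identity substitution both premises become sets, are weakened to the
    joint context and cut there.\<close>
  show "cum S (sq id NV (G + G') (D + D'))"
  proof (rule cum_cut)
    show "cum S (insert (Ante F) (sq id NV (G + G') (D + D')))"
      by (rule cum_mono[OF derivable_imp_cum[OF assms(2), of id NV]]) (auto simp: sq_def)
    show "cum S (insert (Succ F) (sq id NV (G + G') (D + D')))"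
      by (rule cum_mono[OF derivable_imp_cum[OF assms(1), of id NV]]) (auto simp: sq_def)
  qed
  \<comment> \<open>The resulting set consists of the formulas of the target sequent, each covered
    by its own occurrence.\<close>
  show "cov (G + G') (D + D') H" if "H \<in> sq id NV (G + G') (D + D')" for H
    using that unfolding sq_def by (auto intro: cov.intros)
qed

end
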